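(* Let $v_0,\ldots,v_M$ be the functions on $\mathcal{D}\times\mathcal{D}$ defined recursively in the multi-resolution approximation ($M$-RA) of $y_0(\cdot)\sim GP(0,C_0)$ based on knots $\mathcal{Q}_0,\ldots,\mathcal{Q}_M$ and modulating functions $T_0,\ldots,T_M$. If $\mathbf{q}\in\mathcal{Q}_m$, then $v_{m+l}(\mathbf{q},\mathbf{s})=0$ for any $\mathbf{s}\in\mathcal{D}$ and any $l\ge 1$ (with $m+l\le M$).
   Context: Let $\mathcal{D}\subset\mathbb{R}^d$ with $d\ge 1$, let $C_0$ be a positive-definite covariance function on $\mathcal{D}$. Let $M\in\mathbb{N}$. For $m=0,\ldots,M$, $\mathcal{Q}_m=\{\mathbf{q}_{m,1},\ldots,\mathbf{q}_{m,r_m}\}\subset\mathcal{D}$ is a finite set of $r_m$ knots, with $r_0<r_1<\cdots<r_M$. For $m=0,\ldots,M$, the modulating function $T_m:\mathcal{D}\times\mathcal{D}\to[0,1]$ is a symmetric nonnegative-definite function with $T_m(\mathbf{s},\mathbf{s})=1$ for all $\mathbf{s}$ (and equal to $0$ at pairs of locations that are sufficiently far apart, where "far" depends on $m$). For finite sets $A,B\subset\mathcal{D}$ and a function $f$ on $\mathcal{D}\times\mathcal{D}$, $f(A,B)$ denotes the matrix of values of $f$; similarly $f(\mathbf{s},B)$ is a row vector. Define recursively $v_0(\mathbf{s}_1,\mathbf{s}_2)=C_0(\mathbf{s}_1,\mathbf{s}_2)\,T_0(\mathbf{s}_1,\mathbf{s}_2)$; $\mathbf{b}_m(\mathbf{s})'=v_m(\mathbf{s},\mathcal{Q}_m)$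 and $\boldsymbol{\Lambda}_m=v_m(\mathcal{Q}_m,\mathcal{Q}_m)$; and for $m=0,\ldots,M-1$, $$v_{m+1}(\mathbf{s}_1,\mathbf{s}_2)=\big(v_m(\mathbf{s}_1,\mathbf{s}_2)-\mathbf{b}_m(\mathbf{s}_1)'\boldsymbol{\Lambda}_m^{-1}\mathbf{b}_m(\mathbf{s}_2)\big)\cdot T_{m+1}(\mathbf{s}_1,\mathbf{s}_2).$$ The matrices $\boldsymbol{\Lambda}_m$ whose inverses appear are assumed invertible. *)

theory Defs
  imports
    "HOL-Analysis.Finite_Cartesian_Product"
    "Jordan_Normal_Form.Gauss_Jordan_Elimination"
begin

definition symmetric_on :: "'a set \<Rightarrow> ('a \<Rightarrow> 'a \<Rightarrow> real) \<Rightarrow> bool" where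
  "symmetric_on D f \<longleftrightarrow> (\<forall>s\<in>D. \<forall>t\<in>D. f s t = f t s)"

definition nonneg_definite_on :: "'a set \<Rightarrow> ('a \<Rightarrow> 'a \<Rightarrow> real) \<Rightarrow> bool" where
  "nonneg_definite_on D f \<longleftrightarrow>
     (\<forall>A c. finite A \<and> A \<subseteq> D \<longrightarrow> 0 \<le> (\<Sum>s\<in>A. \<Sum>t\<in>A. c s * c t * f s t))"

definition pos_definite_on :: "'a set \<Rightarrow> ('a \<Rightarrow> 'a \<Rightarrow> real) \<Rightarrow> bool" where
  "pos_definite_on D f \<longleftrightarrow>
     (\<forall>A c. finite A \<and> A \<subseteq> D \<and> (\<exists>s\<in>A. c s \<noteq> 0) \<longrightarrow>
        0 < (\<Sum>s\<in>A. \<Sum>t\<in>A. c s * c t * f s t))"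

definition pos_definite_covariance :: "'a set \<Rightarrow> ('a \<Rightarrow> 'a \<Rightarrow> real) \<Rightarrow> bool" where
  "pos_definite_covariance D C \<longleftrightarrow> symmetric_on D C \<and> pos_definite_on D C"

text \<open>The last conjunct says that the function vanishes at pairs of sufficiently distant
  locations; applied to a family of modulating functions, each member has its own cut-off
  distance.\<close>

definition modulating_function :: "'a::metric_space set \<Rightarrow> ('a \<Rightarrow> 'a \<Rightarrow> real) \<Rightarrow> bool" where
  "modulating_function D T \<longleftrightarrow>
     (\<forall>s\<in>D. \<forall>t\<in>D. T s t \<in> {0..1}) \<and>
     symmetric_on D T \<and> nonneg_definite_on D T \<and>
     (\<forall>s\<in>D. T s s = 1) \<and>
     (\<exists>\<delta>>0. \<forall>s\<in>D. \<forall>t\<in>D. dist s t > \<delta> \<longrightarrow> T s t = 0)"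

text \<open>Finite sets of knots are given by distinct lists, whose order indexes the rows and columns
  of the matrices \<open>f(A, B)\<close> and the entries of the vectors \<open>f(s, B)\<close>.\<close>

definition eval_mat :: "('a \<Rightarrow> 'a \<Rightarrow> real) \<Rightarrow> 'a list \<Rightarrow> 'a list \<Rightarrow> real mat" where
  "eval_mat f A B = mat (length A) (length B) (\<lambda>(i, j). f (A ! i) (B ! j))"

definition eval_vec :: "('a \<Rightarrow> 'a \<Rightarrow> real) \<Rightarrow> 'a \<Rightarrow> 'a list \<Rightarrow> real Matrix.vec" where
  "eval_vec f s B = Matrix.vec (length B) (\<lambda>j. f s (B ! j))"

text \<open>\<open>mra_v C0 T Q m\<close> is \<open>v\<^sub>m\<close>. The value \<open>the (mat_inverse \<Lambda>)\<close> is the inverse matrix whenever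
  \<open>\<Lambda>\<close> is invertible, and is unspecified otherwise.\<close>

primrec mra_v ::
  "('a \<Rightarrow> 'a \<Rightarrow> real) \<Rightarrow> (nat \<Rightarrow> 'a \<Rightarrow> 'a \<Rightarrow> real) \<Rightarrow> (nat \<Rightarrow> 'a list) \<Rightarrow> nat \<Rightarrow> 'a \<Rightarrow> 'a \<Rightarrow> real"
where
  "mra_v C0 T Q 0 = (\<lambda>s1 s2. C0 s1 s2 * T 0 s1 s2)"
| "mra_v C0 T Q (Suc m) =
     (let v = mra_v C0 T Q m;
          b = (\<lambda>s. eval_vec v s (Q m));
          \<Lambda> = eval_mat v (Q m) (Q m)
      in (\<lambda>s1 s2. (v s1 s2 - scalar_prod (b s1) (the (mat_inverse \<Lambda>) *\<^sub>v b s2)) * T (Suc m) s1 s2))"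

definition mra_Lambda ::
  "('a \<Rightarrow> 'a \<Rightarrow> real) \<Rightarrow> (nat \<Rightarrow> 'a \<Rightarrow> 'a \<Rightarrow> real) \<Rightarrow> (nat \<Rightarrow> 'a list) \<Rightarrow> nat \<Rightarrow> real mat" where
  "mra_Lambda C0 T Q m = eval_mat (mra_v C0 T Q m) (Q m) (Q m)"

end

theory Submission imports Defs begin

text \<open>For a knot \<open>q\<close> of \<open>Q\<^sub>m\<close>, the vector \<open>b\<^sub>m(q)'\<close> is a row of \<open>\<Lambda>\<^sub>m\<close>, so \<open>b\<^sub>m(q)' \<Lambda>\<^sub>m\<^sup>-\<^sup>1\<close> is a unit vector
  and \<open>b\<^sub>m(q)' \<Lambda>\<^sub>m\<^sup>-\<^sup>1 b\<^sub>m(s) = v\<^sub>m(s, q)\<close>, which equals \<open>v\<^sub>m(q, s)\<close> by symmetry; hence \<open>v\<^sub>m\<^sub>+\<^sub>1(q, s) = 0\<close>.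
  At every later resolution \<open>b(q) = 0\<close>, and the zero persists.\<close>

text \<open>\<open>mat_inverse\<close> is specified through the units of the matrix ring, so
  \<open>invertible_mat\<close> is first turned into membership in \<open>Units\<close>. This makes
  the value under \<open>the\<close> in \<open>mra_v\<close> a genuine two-sided inverse.\<close>

lemma mat_inverse_invertible:
  fixes A :: "'a :: field mat"
  assumes A: "A \<in> carrier_mat n n" and inv: "invertible_mat A"
  shows "the (mat_inverse A) \<in> carrier_mat n n"
    and "A * the (mat_inverse A) = 1\<^sub>m n"
    and "the (mat_inverse A) * A = 1\<^sub>m n"
proof -
  obtain B where AB: "A * B = 1\<^sub>m n" and BA: "B * A = 1\<^sub>m (dim_row B)"
    using inv A unfolding invertible_mat_def inverts_mat_def by auto
  \<comment> \<open>The witness of \<open>invertible_mat\<close> comes without dimensions; counting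
    columns on both sides of the two identities fixes them.\<close>
  have "dim_col B = n" using arg_cong[OF AB, of dim_col] by simp
  moreover have "dim_row B = n" using arg_cong[OF BA, of dim_col] A by simp
  ultimately have B: "B \<in> carrier_mat n n" by auto
  have "A \<in> Units (ring_mat TYPE('a) n ())"
    using A B AB BA unfolding Units_def ring_mat_def by auto
  then obtain C where "mat_inverse A = Some C"
    using mat_inverse(1)[OF A, of "()"] by (cases "mat_inverse A") auto
  with mat_inverse(2)[OF A this]
  show "the (mat_inverse A) \<in> carrier_mat n n"
    and "A * the (mat_inverse A) = 1\<^sub>m n" and "the (mat_inverse A) * A = 1\<^sub>m n"
    by auto
qed

text \<open>Transposing \<open>A * B = 1\<close> makes the transpose of \<open>B\<close> a left
  inverse of \<open>A\<close>, and a left inverse coincides with the right inverse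
  \<open>B\<close>.\<close>

lemma symmetric_inverse_mat:
  fixes A B :: "'a :: comm_ring_1 mat"
  assumes A: "A \<in> carrier_mat n n" and B: "B \<in> carrier_mat n n"
    and AB: "A * B = 1\<^sub>m n" and sym: "transpose_mat A = A"
  shows "transpose_mat B = B"
proof -
  have BT: "transpose_mat B \<in> carrier_mat n n" using B by simp
  have BTA: "transpose_mat B * A = 1\<^sub>m n"
    using transpose_mult[OF A B] AB sym by simp
  have "transpose_mat B = transpose_mat B * (A * B)" using AB BT by simp
  also have "\<dots> = (transpose_mat B * A) * B" using assoc_mult_mat[OF BT A B] by simp
  also have "\<dots> = B" using BTA B by simp
  finally show ?thesis .
qed

lemma scalar_prod_symmetric_mat:
  fixes A :: "'a :: comm_semiring_0 mat"
  assumes A: "A \<in> carrier_mat n n" and sym: "transpose_mat A = A"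
    and x: "x \<in> carrier_vec n" and y: "y \<in> carrier_vec n"
  shows "scalar_prod x (A *\<^sub>v y) = scalar_prod y (A *\<^sub>v x)"
proof -
  have "scalar_prod x (A *\<^sub>v y) = scalar_prod (A *\<^sub>v x) y"
    using transpose_vec_mult_scalar[OF A y x] unfolding sym ..
  also have "\<dots> = scalar_prod y (A *\<^sub>v x)"
    by (rule comm_scalar_prod[OF mult_mat_vec_carrier[OF A x] y])
  finally show ?thesis .
qed

lemma eval_mat_carrier: "eval_mat f A B \<in> carrier_mat (length A) (length B)"
  by (simp add: eval_mat_def)

lemma eval_vec_carrier: "eval_vec f s B \<in> carrier_vec (length B)"
  by (simp add: eval_vec_def)

lemma transpose_eval_mat:
  assumes "symmetric_on D f" and "set A \<subseteq> D"
  shows "transpose_mat (eval_mat f A A) = eval_mat f A A"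
proof (rule eq_matI)
  fix i j
  assume "i < dim_row (eval_mat f A A)" "j < dim_col (eval_mat f A A)"
  then have ij: "i < length A" "j < length A" by (auto simp: eval_mat_def)
  then have "A ! i \<in> D" "A ! j \<in> D" using assms(2) by (auto dest: nth_mem)
  then show "transpose_mat (eval_mat f A A) $$ (i, j) = eval_mat f A A $$ (i, j)"
    using ij assms(1) by (simp add: eval_mat_def symmetric_on_def)
qed (auto simp: eval_mat_def)

lemma mra_v_Suc:
  "mra_v C0 T Q (Suc m) s t =
    (mra_v C0 T Q m s t - scalar_prod (eval_vec (mra_v C0 T Q m) s (Q m))
       (the (mat_inverse (mra_Lambda C0 T Q m)) *\<^sub>v eval_vec (mra_v C0 T Q m) t (Q m)))
     * T (Suc m) s t"
  by (simp add: Let_def mra_Lambda_def)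

text \<open>Each refinement preserves symmetry: \<Lambda> inherits it from v, its inverse from
  \<Lambda>, hence so does the subtracted bilinear form, and the factor T is symmetric. Level m
  involves the inverses of lower levels only, but T up to m itself.\<close>

lemma mra_v_symmetric:
  assumes C0: "symmetric_on D C0"
    and T: "\<And>k. k \<le> m \<Longrightarrow> symmetric_on D (T k)"
    and Q: "\<And>k. k < m \<Longrightarrow> set (Q k) \<subseteq> D"
    and inv: "\<And>k. k < m \<Longrightarrow> invertible_mat (mra_Lambda C0 T Q k)"
  shows "symmetric_on D (mra_v C0 T Q m)"
  using T Q inv
proof (induction m)
  case 0
  then show ?case using C0 by (simp add: symmetric_on_def)
next
  case (Suc m)
  let ?v = "mra_v C0 T Q m" and ?L = "mra_Lambda C0 T Q m"
  let ?b = "\<lambda>s. eval_vec ?v s (Q m)" and ?I = "the (mat_inverse ?L)"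
  have IH: "symmetric_on D ?v" using Suc by simp
  have L: "?L \<in> carrier_mat (length (Q m)) (length (Q m))"
    by (simp add: mra_Lambda_def eval_mat_carrier)
  have invL: "invertible_mat ?L" using Suc.prems(3) by simp
  have LT: "transpose_mat ?L = ?L"
    using transpose_eval_mat[OF IH] Suc.prems(2) by (simp add: mra_Lambda_def)
  note I = mat_inverse_invertible[OF L invL]
  have IT: "transpose_mat ?I = ?I" by (rule symmetric_inverse_mat[OF L I(1,2) LT])
  have "scalar_prod (?b s) (?I *\<^sub>v ?b t) = scalar_prod (?b t) (?I *\<^sub>v ?b s)" for s t
    by (rule scalar_prod_symmetric_mat[OF I(1) IT eval_vec_carrier eval_vec_carrier])
  then show ?case
    using IH Suc.prems(1)[of "Suc m"] unfolding symmetric_on_def mra_v_Suc by simp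
qed

lemma mra_v_Suc_knot:
  assumes sym: "symmetric_on D (mra_v C0 T Q m)"
    and inv: "invertible_mat (mra_Lambda C0 T Q m)"
    and Q: "set (Q m) \<subseteq> D" and q: "q \<in> set (Q m)" and s: "s \<in> D"
  shows "mra_v C0 T Q (Suc m) q s = 0"
proof -
  let ?v = "mra_v C0 T Q m" and ?L = "mra_Lambda C0 T Q m"
  let ?b = "\<lambda>s. eval_vec ?v s (Q m)" and ?I = "the (mat_inverse ?L)"
  let ?n = "length (Q m)"
  obtain i where i: "i < ?n" "q = Q m ! i" using q by (auto simp: in_set_conv_nth)
  have L: "?L \<in> carrier_mat ?n ?n" by (simp add: mra_Lambda_def eval_mat_carrier)
  note I = mat_inverse_invertible[OF L inv]
  have b: "?b s \<in> carrier_vec ?n" by (rule eval_vec_carrier)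
  have row: "?b q = row ?L i"
    using i by (auto simp: mra_Lambda_def eval_mat_def eval_vec_def)
  \<comment> \<open>Reading the scalar product as entry i of a matrix-vector product lets
    associativity cancel \<Lambda> against its inverse, without forming a unit vector.\<close>
  have "scalar_prod (?b q) (?I *\<^sub>v ?b s) = vec_index (?L *\<^sub>v (?I *\<^sub>v ?b s)) i"
    using row i L by simp
  also have "?L *\<^sub>v (?I *\<^sub>v ?b s) = (?L * ?I) *\<^sub>v ?b s"
    using assoc_mult_mat_vec[OF L I(1) b] by simp
  also have "\<dots> = ?b s" using I(2) b by simp
  also have "vec_index (?b s) i = ?v s q" using i by (simp add: eval_vec_def)
  also have "\<dots> = ?v q s" using sym s q Q by (auto simp: symmetric_on_def)
  finally show ?thesis unfolding mra_v_Suc by simp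
qed

lemma mra_v_Suc_zero:
  assumes zero: "\<And>t. t \<in> D \<Longrightarrow> mra_v C0 T Q m q t = 0"
    and inv: "invertible_mat (mra_Lambda C0 T Q m)"
    and Q: "set (Q m) \<subseteq> D" and s: "s \<in> D"
  shows "mra_v C0 T Q (Suc m) q s = 0"
proof -
  let ?n = "length (Q m)" and ?I = "the (mat_inverse (mra_Lambda C0 T Q m))"
  have L: "mra_Lambda C0 T Q m \<in> carrier_mat ?n ?n"
    by (simp add: mra_Lambda_def eval_mat_carrier)
  have b: "eval_vec (mra_v C0 T Q m) q (Q m) = 0\<^sub>v ?n"
    using zero Q by (auto simp: eval_vec_def subset_iff)
  \<comment> \<open>Invertibility gives the inverse its dimension, so the scalar product with the
    zero vector of length \<open>?n\<close> is 0.\<close>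
  have "?I *\<^sub>v eval_vec (mra_v C0 T Q m) s (Q m) \<in> carrier_vec ?n"
    using mat_inverse_invertible(1)[OF L inv] eval_vec_carrier by (rule mult_mat_vec_carrier)
  then show ?thesis unfolding mra_v_Suc b using zero[OF s] by simp
qed

theorem proposition2:
  fixes D :: "(real ^ 'd) set"
    and C0 :: "real ^ 'd \<Rightarrow> real ^ 'd \<Rightarrow> real"
    and T :: "nat \<Rightarrow> real ^ 'd \<Rightarrow> real ^ 'd \<Rightarrow> real"
    and Q :: "nat \<Rightarrow> (real ^ 'd) list"
    and M m l :: nat
    and q s :: "real ^ 'd"
  assumes "pos_definite_covariance D C0"
    and "\<And>k. k \<le> M \<Longrightarrow> distinct (Q k) \<and> set (Q k) \<subseteq> D"
    and "\<And>k. k < M \<Longrightarrow> length (Q k) < length (Q (Suc k))"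
    and "\<And>k. k \<le> M \<Longrightarrow> modulating_function D (T k)"
    and "\<And>k. k < M \<Longrightarrow> invertible_mat (mra_Lambda C0 T Q k)"
    and "l \<ge> 1" and "m + l \<le> M"
    and "q \<in> set (Q m)" and "s \<in> D"
  shows "mra_v C0 T Q (m + l) q s = 0"
proof -
  \<comment> \<open>The claim is proved for all \<open>t\<close> in \<open>D\<close> at once: the
    induction step needs the zeros at the knots of the current level, so that b(q) vanishes, as well
    as at \<open>t\<close> itself.\<close>
  have "mra_v C0 T Q (m + l) q t = 0" if "t \<in> D" for t
    using \<open>l \<ge> 1\<close> \<open>m + l \<le> M\<close> that
  proof (induction l arbitrary: t rule: dec_induct)
    case base
    have "symmetric_on D (mra_v C0 T Q m)"
      using assms base by (intro mra_v_symmetric)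
        (auto simp: pos_definite_covariance_def modulating_function_def)
    then have "mra_v C0 T Q (Suc m) q t = 0"
      using assms(2,5,8) base by (intro mra_v_Suc_knot) auto
    then show ?case by simp
  next
    case (step l)
    have "mra_v C0 T Q (Suc (m + l)) q t = 0"
      using assms(2,5) step by (intro mra_v_Suc_zero[where D = D]) auto
    then show ?case by simp
  qed
  then show ?thesis using \<open>s \<in> D\<close> .
qed

end
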